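(* Let $L>0$, $\mu>0$, let $f:\mathbb{R}^d\to\mathbb{R}$ be convex and differentiable with $L$-Lipschitz continuous gradient, let $h:\mathbb{R}^d\to\mathbb{R}\cup\{+\infty\}$ be closed, proper and convex, and let $F=f+h$ have a nonempty set of global minimizers, with minimum value $F_*$. Let $x_1\in\mathbb{R}^d$, and suppose that $d(0,\partial F(x))^2\ge 2\mu(F(x)-F_* )$ for all $x$ with $F(x)\le F(x_1)$. Define the worst-case rate bound $\tau:(0,\frac2L)\to\mathbb{R}$ by $$\tau(\gamma)=\begin{cases}\dfrac{1}{2\gamma\mu+1}, & \gamma\in\left(0,\frac{3}{2L}\right],\\[2ex] \dfrac{(L\gamma-1)^2}{(L\gamma-1)^2-L\gamma^2\mu+2\gamma\mu}, & \gamma\in\left(\frac{3}{2L},\frac2L\right).\end{cases}$$ Then the optimal step size for this bound, i.e. the minimizer of $\tau$ over $(0,\frac2L)$, is $\gamma=\frac{3}{2L}$.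
   Context: $\partial F(x)$ is the (Clarke) subdifferential, which here equals $\nabla f(x)+\partial h(x)$ with $\partial h$ the convex subdifferential; $d(0,S)=\inf_{s\in S}\|s\|$ for nonempty $S$, with the convention $d(0,\emptyset)=+\infty$. The function $\tau(\gamma)$ is the contraction factor in the bound $F(x_2)-F_*\le\tau(\gamma)(F(x_1)-F_* )$ for one proximal gradient step $x_2=\mathrm{prox}_{\gamma h}(x_1-\gamma\nabla f(x_1))$, where $\mathrm{prox}_g(x)=\operatorname{argmin}_y\{g(y)+\frac12\|y-x\|^2\}$. "Optimal" step size means the one minimizing this bound. *)

theory Defs
  imports "HOL-Analysis.Analysis"
begin

definition epi :: "('a \<Rightarrow> ereal) \<Rightarrow> ('a \<times> real) set" where
  "epi h = {(x, t). h x \<le> ereal t}"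

definition proper :: "('a \<Rightarrow> ereal) \<Rightarrow> bool" where
  "proper h \<longleftrightarrow> (\<forall>x. h x \<noteq> -\<infinity>) \<and> (\<exists>x. h x \<noteq> \<infinity>)"

definition closed_proper_convex :: "('a::euclidean_space \<Rightarrow> ereal) \<Rightarrow> bool" where
  "closed_proper_convex h \<longleftrightarrow> closed (epi h) \<and> proper h \<and> convex (epi h)"

(* The sequential form of Clarke's tangent cone; his normal cone is its polar, and the
   subdifferential of an extended-valued function is read off from the normals (s, -1)
   to the epigraph. It is empty outside the effective domain. *)

definition clarke_tangent_cone :: "'a::real_inner set \<Rightarrow> 'a \<Rightarrow> 'a set" where
  "clarke_tangent_cone S x =
     {v. \<forall>y t. (\<forall>k. y k \<in> S) \<and> y \<longlonglongrightarrow> x \<and> (\<forall>k. 0 < t k) \<and> t \<longlonglongrightarrow> (0::real) \<longrightarrow>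
           (\<exists>w. w \<longlonglongrightarrow> v \<and> (\<forall>k::nat. y k + t k *\<^sub>R w k \<in> S))}"

definition clarke_normal_cone :: "'a::real_inner set \<Rightarrow> 'a \<Rightarrow> 'a set" where
  "clarke_normal_cone S x = {n. \<forall>v\<in>clarke_tangent_cone S x. n \<bullet> v \<le> 0}"

definition clarke_subdiff :: "('a::euclidean_space \<Rightarrow> ereal) \<Rightarrow> 'a \<Rightarrow> 'a set" where
  "clarke_subdiff F x =
     {s. \<bar>F x\<bar> \<noteq> \<infinity> \<and> (s, -1) \<in> clarke_normal_cone (epi F) (x, real_of_ereal (F x))}"

definition convex_subdiff :: "('a::euclidean_space \<Rightarrow> ereal) \<Rightarrow> 'a \<Rightarrow> 'a set" where
  "convex_subdiff h x = {s. \<bar>h x\<bar> \<noteq> \<infinity> \<and> (\<forall>y. h x + ereal (s \<bullet> (y - x)) \<le> h y)}"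

(* Unlike infdist, this is \<infinity> for the empty set. *)
definition dist0 :: "'a::real_normed_vector set \<Rightarrow> ereal" where
  "dist0 S = (INF s\<in>S. ereal (norm s))"

(* Only the values for 0 < \<gamma> < 2 / L are meaningful. *)
definition rate_bound :: "real \<Rightarrow> real \<Rightarrow> real \<Rightarrow> real" where
  "rate_bound L \<mu> \<gamma> =
     (if \<gamma> \<le> 3 / (2 * L) then 1 / (2 * \<gamma> * \<mu> + 1)
      else (L * \<gamma> - 1)\<^sup>2 / ((L * \<gamma> - 1)\<^sup>2 - L * \<gamma>\<^sup>2 * \<mu> + 2 * \<gamma> * \<mu>))"

lemma clarke_normal_cone_convex:
  assumes S: "convex S" and x: "x \<in> S"
  shows "clarke_normal_cone S x = {n. \<forall>y\<in>S. n \<bullet> (y - x) \<le> 0}"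
proof (intro equalityI subsetI)
  fix n assume n: "n \<in> clarke_normal_cone S x"
  have "y - x \<in> clarke_tangent_cone S x" if y: "y \<in> S" for y
    unfolding clarke_tangent_cone_def
  proof (intro CollectI allI impI)
    fix z :: "nat \<Rightarrow> 'a" and t :: "nat \<Rightarrow> real"
    assume A: "(\<forall>k. z k \<in> S) \<and> z \<longlonglongrightarrow> x \<and> (\<forall>k. 0 < t k) \<and> t \<longlonglongrightarrow> 0"
    define w where "w k = (if t k \<le> 1 then y - z k else 0)" for k
    have "eventually (\<lambda>k. t k < 1) sequentially"
      using A by (auto intro: order_tendstoD)
    then have "eventually (\<lambda>k. y - z k = w k) sequentially"
      by (rule eventually_mono) (auto simp: w_def)
    moreover have "(\<lambda>k. y - z k) \<longlonglongrightarrow> y - x"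
      using A by (auto intro: tendsto_intros)
    ultimately have "w \<longlonglongrightarrow> y - x"
      by (rule Lim_transform_eventually[rotated])
    moreover have "z k + t k *\<^sub>R w k \<in> S" for k
    proof (cases "t k \<le> 1")
      case True
      have "(1 - t k) *\<^sub>R z k + t k *\<^sub>R y \<in> S"
        using A y True by (intro convexD[OF S]) (auto simp: less_imp_le)
      then show ?thesis using True by (simp add: w_def algebra_simps)
    qed (use A in \<open>simp add: w_def\<close>)
    ultimately show "\<exists>w. w \<longlonglongrightarrow> y - x \<and> (\<forall>k. z k + t k *\<^sub>R w k \<in> S)" by blast
  qed
  then show "n \<in> {n. \<forall>y\<in>S. n \<bullet> (y - x) \<le> 0}"
    using n by (auto simp: clarke_normal_cone_def)
next
  fix n assume "n \<in> {n. \<forall>y\<in>S. n \<bullet> (y - x) \<le> 0}"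
  then have n: "n \<bullet> (y - x) \<le> 0" if "y \<in> S" for y using that by blast
  have "n \<bullet> v \<le> 0" if v: "v \<in> clarke_tangent_cone S x" for v
  proof -
    have "(\<lambda>k. inverse (real (Suc k))) \<longlonglongrightarrow> 0" by (rule LIMSEQ_inverse_real_of_nat)
    then obtain w where w: "w \<longlonglongrightarrow> v" "\<And>k. x + inverse (real (Suc k)) *\<^sub>R w k \<in> S"
      using v[unfolded clarke_tangent_cone_def, THEN CollectD, rule_format,
          of "\<lambda>_. x" "\<lambda>k. inverse (real (Suc k))"] x by auto
    have "n \<bullet> w k \<le> 0" for k
      using n[OF w(2)[of k]] by (simp add: mult_le_0_iff)
    then show ?thesis
      by (intro LIMSEQ_le_const2[OF tendsto_inner[OF tendsto_const w(1)]]) auto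
  qed
  then show "n \<in> clarke_normal_cone S x" by (simp add: clarke_normal_cone_def)
qed

lemma clarke_subdiff_add:
  fixes f :: "'a::euclidean_space \<Rightarrow> real"
  assumes f: "convex_on UNIV f" and g: "GDERIV f x :> g"
    and h: "proper h" "convex (epi h)"
  shows "clarke_subdiff (\<lambda>x. ereal (f x) + h x) x = (+) g ` convex_subdiff h x"
proof (cases "\<bar>h x\<bar> = \<infinity>")
  case True
  then show ?thesis by (auto simp: clarke_subdiff_def convex_subdiff_def)
next
  case False
  then obtain b where b: "h x = ereal b" by (cases "h x") auto
  have epiF: "(y, r) \<in> epi (\<lambda>x. ereal (f x) + h x) \<longleftrightarrow> (y, r - f y) \<in> epi h" for y r
    by (cases "h y") (auto simp: epi_def)
  have conv: "convex (epi (\<lambda>x. ereal (f x) + h x))"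
  proof (rule convexI)
    fix p q :: "'a \<times> real" and u v :: real
    assume *: "p \<in> epi (\<lambda>x. ereal (f x) + h x)" "q \<in> epi (\<lambda>x. ereal (f x) + h x)"
      "0 \<le> u" "0 \<le> v" "u + v = 1"
    obtain y r z s where pq: "p = (y, r)" "q = (z, s)" by (cases p, cases q) auto
    have "u *\<^sub>R (y, r - f y) + v *\<^sub>R (z, s - f z) \<in> epi h"
      using * unfolding pq epiF by (intro convexD[OF h(2)]) auto
    then have 1: "h (u *\<^sub>R y + v *\<^sub>R z) \<le> ereal (u * (r - f y) + v * (s - f z))"
      by (simp add: epi_def)
    have 2: "f (u *\<^sub>R y + v *\<^sub>R z) \<le> u * f y + v * f z"
      using f * by (auto simp: convex_on_def)
    have "h (u *\<^sub>R y + v *\<^sub>R z) \<le> ereal (u * r + v * s - f (u *\<^sub>R y + v *\<^sub>R z))"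
      by (rule order_trans[OF 1]) (use 2 in \<open>simp add: algebra_simps\<close>)
    then show "u *\<^sub>R p + v *\<^sub>R q \<in> epi (\<lambda>x. ereal (f x) + h x)"
      unfolding pq by (simp add: epiF) (simp add: epi_def)
  qed
  have lim: "((\<lambda>t. (f (x + t *\<^sub>R d) - f x) / t) \<longlongrightarrow> g \<bullet> d) (at_right 0)" for d
  proof -
    have "(f has_derivative (\<lambda>y. y \<bullet> g)) (at (x + 0 *\<^sub>R d))"
      using g by (simp add: gderiv_def)
    then have "((\<lambda>t. f (x + t *\<^sub>R d)) has_derivative (\<lambda>t. (t *\<^sub>R d) \<bullet> g)) (at 0)"
      by (rule has_derivative_compose[rotated]) (auto intro!: derivative_eq_intros)
    then have "((\<lambda>t. f (x + t *\<^sub>R d)) has_field_derivative (g \<bullet> d)) (at 0)"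
      unfolding has_field_derivative_def
      by (rule has_derivative_eq_rhs) (simp add: fun_eq_iff inner_commute)
    then have "((\<lambda>t. (f (x + t *\<^sub>R d) - f x) / t) \<longlongrightarrow> g \<bullet> d) (at 0)"
      by (simp add: has_field_derivative_iff)
    then show ?thesis by (rule filterlim_mono) (auto simp: at_le)
  qed
  have ev: "eventually (\<lambda>t::real. 0 < t \<and> t \<le> 1) (at_right 0)"
    by (auto simp: eventually_at_right_field intro!: exI[of _ 1])
  have grad: "g \<bullet> (y - x) \<le> f y - f x" for y
  proof (rule tendsto_upperbound[OF lim])
    show "eventually (\<lambda>t. (f (x + t *\<^sub>R (y - x)) - f x) / t \<le> f y - f x) (at_right 0)"
      using ev
    proof (rule eventually_mono)
      fix t :: real assume t: "0 < t \<and> t \<le> 1"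
      have "f ((1 - t) *\<^sub>R x + t *\<^sub>R y) \<le> (1 - t) * f x + t * f y"
        using t by (intro convex_onD[OF f]) auto
      moreover have "(1 - t) *\<^sub>R x + t *\<^sub>R y = x + t *\<^sub>R (y - x)" by (simp add: algebra_simps)
      ultimately have "f (x + t *\<^sub>R (y - x)) - f x \<le> (f y - f x) * t"
        by (simp only:) (simp add: algebra_simps)
      then show "(f (x + t *\<^sub>R (y - x)) - f x) / t \<le> f y - f x"
        using t by (simp add: pos_divide_le_eq)
    qed
  qed simp
  have F: "s \<in> clarke_subdiff (\<lambda>x. ereal (f x) + h x) x \<longleftrightarrow>
      (\<forall>y r. (y, r) \<in> epi h \<longrightarrow> s \<bullet> (y - x) \<le> f y - f x + (r - b))" for s
  proof -
    have "(x, f x + b) \<in> epi (\<lambda>x. ereal (f x) + h x)" by (simp add: epi_def b)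
    note N = clarke_normal_cone_convex[OF conv this]
    have le: "c + (f x + b - r) \<le> 0 \<longleftrightarrow> c \<le> r - (f x + b)" for c r by linarith
    have "s \<in> clarke_subdiff (\<lambda>x. ereal (f x) + h x) x \<longleftrightarrow>
      (\<forall>y r. (y, r - f y) \<in> epi h \<longrightarrow> s \<bullet> (y - x) \<le> r - (f x + b))"
      by (simp add: clarke_subdiff_def b epiF[symmetric] N Ball_def le)
    also have "\<dots> \<longleftrightarrow> (\<forall>y r. (y, r) \<in> epi h \<longrightarrow> s \<bullet> (y - x) \<le> f y - f x + (r - b))"
    proof (safe, goal_cases)
      case (1 y r)
      from 1(1)[rule_format, of y "r + f y"] 1(2) have "s \<bullet> (y - x) \<le> r + f y - (f x + b)" by simp
      then show ?case by linarith
    next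
      case (2 y r)
      from 2(1)[rule_format, OF 2(2)] show ?case by linarith
    qed
    finally show ?thesis .
  qed
  have H: "s \<in> convex_subdiff h x \<longleftrightarrow> (\<forall>y r. (y, r) \<in> epi h \<longrightarrow> s \<bullet> (y - x) \<le> r - b)" for s
  proof -
    have "ereal b + ereal c \<le> h y \<longleftrightarrow> (\<forall>r. h y \<le> ereal r \<longrightarrow> c \<le> r - b)" for c y
      using h(1) by (cases "h y") (auto simp: proper_def algebra_simps intro: order_trans)
    then show ?thesis by (simp add: convex_subdiff_def b epi_def)
  qed
  have sub: "(s - g) \<bullet> (y - x) \<le> r - b"
    if s: "\<And>y r. (y, r) \<in> epi h \<Longrightarrow> s \<bullet> (y - x) \<le> f y - f x + (r - b)"
      and yr: "(y, r) \<in> epi h" for s y r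
  proof -
    have "s \<bullet> (y - x) - (r - b) \<le> g \<bullet> (y - x)"
    proof (rule tendsto_lowerbound[OF lim])
      show "eventually (\<lambda>t. s \<bullet> (y - x) - (r - b) \<le> (f (x + t *\<^sub>R (y - x)) - f x) / t) (at_right 0)"
        using ev
      proof (rule eventually_mono)
        fix t :: real assume t: "0 < t \<and> t \<le> 1"
        have "(1 - t) *\<^sub>R (x, b) + t *\<^sub>R (y, r) \<in> epi h"
          using t yr by (intro convexD[OF h(2)]) (auto simp: epi_def b)
        moreover have "(1 - t) *\<^sub>R (x, b) + t *\<^sub>R (y, r) = (x + t *\<^sub>R (y - x), b + t * (r - b))"
          by (simp add: algebra_simps)
        ultimately have "s \<bullet> (t *\<^sub>R (y - x)) \<le> f (x + t *\<^sub>R (y - x)) - f x + t * (r - b)"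
          using s[of "x + t *\<^sub>R (y - x)" "b + t * (r - b)"] by simp
        then have "(s \<bullet> (y - x) - (r - b)) * t \<le> f (x + t *\<^sub>R (y - x)) - f x"
          unfolding inner_scaleR_right by (simp add: left_diff_distrib mult.commute[of t])
        then show "s \<bullet> (y - x) - (r - b) \<le> (f (x + t *\<^sub>R (y - x)) - f x) / t"
          using t by (simp add: pos_le_divide_eq)
      qed
    qed simp
    then show ?thesis by (simp add: inner_diff_left)
  qed
  show ?thesis
  proof (intro equalityI subsetI)
    fix s assume "s \<in> clarke_subdiff (\<lambda>x. ereal (f x) + h x) x"
    then have "s - g \<in> convex_subdiff h x" unfolding F H using sub by blast
    then show "s \<in> (+) g ` convex_subdiff h x" by (intro image_eqI[of _ _ "s - g"]) auto
  next
    fix s assume "s \<in> (+) g ` convex_subdiff h x"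
    then obtain p where p: "s = g + p" "p \<in> convex_subdiff h x" by auto
    show "s \<in> clarke_subdiff (\<lambda>x. ereal (f x) + h x) x"
      unfolding F
    proof (intro allI impI)
      fix y r assume "(y, r) \<in> epi h"
      then have "p \<bullet> (y - x) \<le> r - b" using p(2) H by blast
      then show "s \<bullet> (y - x) \<le> f y - f x + (r - b)"
        using grad[of y] by (simp add: p(1) inner_add_left)
    qed
  qed
qed

end

theory Submission
  imports Defs
begin

text \<open>
  The minimizer sits at the kink because the bound falls before \<open>3 / (2 * L)\<close> and rises
  after it. Before, it is the reciprocal of an increasing affine function. After, everything
  depends on the square \<open>u = (L * \<gamma> - 1)\<^sup>2\<close> alone: with
  \<open>\<kappa> = \<mu> / L\<close>, completing the square gives \<open>2 * \<gamma> * \<mu> - L * \<gamma>\<^sup>2 * \<mu> = \<kappa> * (1 - u)\<close>,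
  so the bound is \<open>u / (u + \<kappa> * (1 - u))\<close>, which grows with \<open>u\<close> on \<open>{0..1}\<close>, and \<open>u\<close> grows with
  \<open>\<gamma>\<close> as soon as \<open>\<gamma> \<ge> 1 / L\<close>. At the kink \<open>u = 1 / 4\<close>, where both formulas give
  \<open>1 / (1 + 3 * \<kappa>)\<close>; the bound is therefore continuous there and the two monotone pieces
  share the end point, which is then the only minimizer.
\<close>

lemma rate_bound_strict_antimono_short_step:
  assumes "0 < \<mu>" "0 < \<gamma>" "\<gamma> < \<gamma>'" "\<gamma>' \<le> 3 / (2 * L)"
  shows "rate_bound L \<mu> \<gamma>' < rate_bound L \<mu> \<gamma>"
  using assms by (simp add: rate_bound_def frac_less2 add_pos_pos)

text \<open>
  Including the end point \<open>3 / (2 * L)\<close>, where the definition uses the other formula,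
  records that the two pieces agree there.
\<close>

lemma rate_bound_long_step:
  assumes L: "0 < L" and \<gamma>: "3 / (2 * L) \<le> \<gamma>"
  defines "u \<equiv> (L * \<gamma> - 1)\<^sup>2"
  shows "rate_bound L \<mu> \<gamma> = u / (u + \<mu> / L * (1 - u))"
proof (cases "\<gamma> = 3 / (2 * L)")
  case True
  have u: "u = 1 / 4"
    using L by (simp add: u_def True power2_eq_square)
  have r: "rate_bound L \<mu> \<gamma> = 1 / (1 + 3 * (\<mu> / L))"
    using L by (simp add: rate_bound_def True add.commute)
  from u have d: "u + \<mu> / L * (1 - u) = (1 + 3 * (\<mu> / L)) / 4"
    by (simp only:) (simp add: add_divide_distrib)
  show ?thesis unfolding r d u by simp
next
  case False
  have "\<mu> / L * (1 - u) = 2 * \<gamma> * \<mu> - L * \<gamma>\<^sup>2 * \<mu>"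
    using L by (simp add: u_def power2_eq_square field_simps)
  then show ?thesis
    using False \<gamma> by (simp add: rate_bound_def u_def algebra_simps)
qed

text \<open>
  Cross-multiplying leaves \<open>v * (1 - w) < w * (1 - v)\<close>, in which the products cancel.
\<close>

lemma strict_mono_weight_ratio:
  fixes k v w :: real
  assumes "0 < k" "0 < v" "v < w" "w < 1"
  shows "v / (v + k * (1 - v)) < w / (w + k * (1 - w))"
proof -
  have "k * (v * (1 - w)) < k * (w * (1 - v))"
    using assms by (intro mult_strict_left_mono) (auto simp: algebra_simps)
  then have "v * (w + k * (1 - w)) < w * (v + k * (1 - v))"
    by (simp add: algebra_simps)
  moreover have "0 < v + k * (1 - v)" "0 < w + k * (1 - w)"
    using assms by (auto intro!: add_pos_pos)
  ultimately show ?thesis by (simp add: divide_less_eq pos_less_divide_eq field_simps)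
qed

lemma rate_bound_strict_mono_long_step:
  assumes L: "0 < L" and \<mu>: "0 < \<mu>"
    and \<gamma>: "3 / (2 * L) \<le> \<gamma>" "\<gamma> < \<gamma>'" "\<gamma>' < 2 / L"
  shows "rate_bound L \<mu> \<gamma> < rate_bound L \<mu> \<gamma>'"
proof -
  have "3 / 2 \<le> L * \<gamma>" "L * \<gamma> < L * \<gamma>'" "L * \<gamma>' < 2"
    using L \<gamma> by (auto simp: field_simps)
  then have "0 < (L * \<gamma> - 1)\<^sup>2" "(L * \<gamma> - 1)\<^sup>2 < (L * \<gamma>' - 1)\<^sup>2" "(L * \<gamma>' - 1)\<^sup>2 < 1"
    by (auto simp: power_strict_mono abs_square_less_1)
  moreover have "0 < \<mu> / L" using L \<mu> by simp
  ultimately show ?thesis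
    using strict_mono_weight_ratio[of "\<mu> / L" "(L * \<gamma> - 1)\<^sup>2" "(L * \<gamma>' - 1)\<^sup>2"]
      rate_bound_long_step[OF L] \<gamma> by simp
qed

theorem proposition4:
  fixes f :: "real ^ 'd \<Rightarrow> real"
    and grad_f :: "real ^ 'd \<Rightarrow> real ^ 'd"
    and h F :: "real ^ 'd \<Rightarrow> ereal"
    and F_star :: ereal
    and L \<mu> :: real
    and x1 :: "real ^ 'd"
  assumes "L > 0" and "\<mu> > 0"
    and "convex_on UNIV f"
    and "\<And>x. GDERIV f x :> grad_f x"
    and "L-lipschitz_on UNIV grad_f"
    and "closed_proper_convex h"
    and "F = (\<lambda>x. ereal (f x) + h x)"
    and "\<exists>x. F x = F_star" and "\<And>x. F_star \<le> F x"
    and "\<And>x. F x \<le> F x1 \<Longrightarrow>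
           (dist0 (clarke_subdiff F x))\<^sup>2 \<ge> ereal (2 * \<mu>) * (F x - F_star)"
  shows "{\<gamma>. is_arg_min (rate_bound L \<mu>) (\<lambda>\<gamma>. \<gamma> \<in> {0<..<2 / L}) \<gamma>} = {3 / (2 * L)}"
proof -
  let ?k = "3 / (2 * L)"
  have k: "?k \<in> {0<..<2 / L}"
    using \<open>L > 0\<close> by (simp add: field_simps)
  have less: "rate_bound L \<mu> ?k < rate_bound L \<mu> \<gamma>"
    if "\<gamma> \<in> {0<..<2 / L}" "\<gamma> \<noteq> ?k" for \<gamma>
  proof (cases "\<gamma> < ?k")
    case True
    then show ?thesis
      using that \<open>\<mu> > 0\<close> by (intro rate_bound_strict_antimono_short_step) auto
  next
    case False
    then show ?thesis
      using that \<open>L > 0\<close> \<open>\<mu> > 0\<close> by (intro rate_bound_strict_mono_long_step) auto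
  qed
  then have "\<not> rate_bound L \<mu> \<gamma> < rate_bound L \<mu> ?k" if "\<gamma> \<in> {0<..<2 / L}" for \<gamma>
    using that by (metis less_asym')
  then show ?thesis
    using k less unfolding is_arg_min_def by blast
qed

end
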